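(* Let $w\geq 2$ be an integer and let $\tilde{a}=(a_0,a_1,a_2,\ldots)$ be a sequence of nonnegative real numbers satisfying $a_{k-1}\leq a_k$ for each $k\in\{1,\ldots,w\}$. For $\tilde{n}=(n_1,\ldots,n_w)$ let $$S_{w;\tilde{a}}(\tilde{n})=\sum_{k=0}^w a_k\left(\sum_{I\in\binom{[w]}{k}}\prod_{i\in I}\binom{n_i+1}{2}\right).$$ If $n_1,\ldots,n_w$ are natural numbers (positive integers) and $\sum_{i=1}^w n_i=n$, then the maximum value of $S_{w;\tilde{a}}(\tilde{n})$ is obtained when $|n_i-n_j|\in\{0,1\}$ for each $i,j\in\{1,\ldots,w\}$. In particular, for fixed natural numbers $n$ and $w$, the $w$-tuple $\tilde{n}$ yielding the maximum value of $S_{w;\tilde{a}}(\tilde{n})$ for integers $n_i\geq 1$ with $\sum_{i=1}^w n_i=n$ is unique up to reordering.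
   Context: $[w]=\{1,\ldots,w\}$, and $\binom{[w]}{k}$ denotes the set of all $k$-element subsets of $[w]$. An empty product equals $1$. $\binom{m+1}{2}=m(m+1)/2$.
   Formalization: Uniqueness of the maximizing tuple up to reordering is stated under the added assumption that a_0,…,a_w are not all zero; otherwise S is identically 0 and, e.g., for w=2, n=4 both (2,2) and (1,3) are maximizers. *)

theory Defs
  imports Complex_Main "HOL-Combinatorics.Permutations"
begin

text \<open>A \<open>w\<close>-tuple \<open>(n\<^sub>1, \<dots>, n\<^sub>w)\<close> is a function \<open>\<nu> :: nat \<Rightarrow> nat\<close> of which only the
  values on \<open>{1..w}\<close> matter.\<close>

definition S :: "nat \<Rightarrow> (nat \<Rightarrow> real) \<Rightarrow> (nat \<Rightarrow> nat) \<Rightarrow> real" where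
  "S w a \<nu> =
     (\<Sum>k = 0..w. a k * (\<Sum>I | I \<subseteq> {1..w} \<and> card I = k. \<Prod>i\<in>I. real ((\<nu> i + 1) choose 2)))"

definition composition :: "nat \<Rightarrow> nat \<Rightarrow> (nat \<Rightarrow> nat) \<Rightarrow> bool" where
  "composition w n \<nu> \<longleftrightarrow> (\<forall>i\<in>{1..w}. \<nu> i \<ge> 1) \<and> (\<Sum>i = 1..w. \<nu> i) = n"

definition balanced :: "nat \<Rightarrow> (nat \<Rightarrow> nat) \<Rightarrow> bool" where
  "balanced w \<nu> \<longleftrightarrow> (\<forall>i\<in>{1..w}. \<forall>j\<in>{1..w}. \<bar>int (\<nu> i) - int (\<nu> j)\<bar> \<in> {0, 1})"

definition reordering :: "nat \<Rightarrow> (nat \<Rightarrow> nat) \<Rightarrow> (nat \<Rightarrow> nat) \<Rightarrow> bool" where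
  "reordering w \<mu> \<nu> \<longleftrightarrow> (\<exists>\<pi>. \<pi> permutes {1..w} \<and> (\<forall>i\<in>{1..w}. \<mu> i = \<nu> (\<pi> i)))"

end

theory Submission
  imports Defs
begin

text \<open>Write \<open>T m = m (m + 1) / 2\<close>. Suppose two parts of a composition differ by at least two,
  \<open>x \<ge> y + 2\<close>. As a function of these two parts, \<open>S\<close> is
  \<open>A\<^sub>0 + A\<^sub>1 (T x + T y) + A\<^sub>2 T x T y\<close>, where \<open>A\<^sub>r\<close> is the same kind of sum over the other parts with
  the weights shifted by \<open>r\<close>. Moving one unit from the larger part to the smaller lowers
  \<open>T x + T y\<close> by \<open>x - y - 1\<close> and raises \<open>T x T y\<close> by \<open>(x - y - 1) x (y + 1) / 2\<close>. Monotonicity of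
  the weights gives \<open>A\<^sub>1 \<le> A\<^sub>2\<close>, and \<open>x (y + 1) / 2 \<ge> 3\<close> because \<open>y \<ge> 1\<close> and \<open>x \<ge> 3\<close>; hence the gain
  outweighs the loss, strictly so when \<open>A\<^sub>2 > 0\<close>, which holds as soon as some weight is nonzero
  (\<open>subset_sum_less_transfer\<close>).

  Such transfers lower the sum of squares, so they end in a balanced composition
  (\<open>ex_balanced_improvement\<close>): every unbalanced composition is strictly beaten by a balanced one.
  Division with remainder shows that a balanced composition has \<open>n mod w\<close> parts
  \<open>n div w + 1\<close> and all others \<open>n div w\<close> (\<open>reordering_if_balanced\<close>), so balanced compositions are
  reorderings of one another. As \<open>S\<close> is symmetric, they all share the same value, which is
  therefore the maximum, and no other composition attains it. If all weights vanish, \<open>S\<close> is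
  constantly zero and every composition is a maximiser.\<close>

section \<open>Weighted sums over subsets\<close>

lemma real_Suc_choose_two: "real ((m + 1) choose 2) = real m * (real m + 1) / 2"
proof -
  have "real ((m + 1) choose 2) = real ((m + 1) * m div 2)"
    by (simp add: choose_two)
  also have "\<dots> = real ((m + 1) * m) / 2"
    by (subst real_of_nat_div) auto
  finally show ?thesis
    by (simp add: algebra_simps)
qed

text \<open>Generalising the index set \<open>{1..w}\<close> of \<open>S\<close> to any finite set, and letting the weights vary,
  makes it possible to split off one index at a time: doing so shifts the weights by one.\<close>

definition subset_sum :: "(nat \<Rightarrow> real) \<Rightarrow> 'a set \<Rightarrow> ('a \<Rightarrow> nat) \<Rightarrow> real" where
  "subset_sum b A \<nu> = (\<Sum>I\<in>Pow A. b (card I) * (\<Prod>i\<in>I. real ((\<nu> i + 1) choose 2)))"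

lemma S_eq_subset_sum: "S w a \<nu> = subset_sum a {1..w} \<nu>"
proof -
  let ?P = "\<lambda>I. \<Prod>i\<in>I. real ((\<nu> i + 1) choose 2)"
  have card_le: "card I \<in> {0..w}" if "I \<in> Pow {1..w}" for I
    using card_mono[of "{1..w}" I] that by simp
  have "S w a \<nu> = (\<Sum>k = 0..w. \<Sum>I | I \<in> Pow {1..w} \<and> card I = k. a (card I) * ?P I)"
    unfolding S_def sum_distrib_left by (intro sum.cong) auto
  also have "\<dots> = subset_sum a {1..w} \<nu>"
    unfolding subset_sum_def using card_le by (intro sum.group) auto
  finally show ?thesis .
qed

lemma subset_sum_cong:
  assumes "\<And>i. i \<in> A \<Longrightarrow> \<mu> i = \<nu> i"
  shows "subset_sum b A \<mu> = subset_sum b A \<nu>"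
  unfolding subset_sum_def
proof (rule sum.cong[OF refl])
  fix I assume "I \<in> Pow A"
  then have "(\<Prod>i\<in>I. real ((\<mu> i + 1) choose 2)) = (\<Prod>i\<in>I. real ((\<nu> i + 1) choose 2))"
    using assms by (intro prod.cong) auto
  then show "b (card I) * (\<Prod>i\<in>I. real ((\<mu> i + 1) choose 2))
    = b (card I) * (\<Prod>i\<in>I. real ((\<nu> i + 1) choose 2))"
    by simp
qed

lemma subset_sum_insert:
  assumes "finite A" "i \<notin> A"
  shows "subset_sum b (insert i A) \<nu>
    = subset_sum b A \<nu> + real ((\<nu> i + 1) choose 2) * subset_sum (\<lambda>k. b (Suc k)) A \<nu>"
proof -
  let ?P = "\<lambda>I. \<Prod>i\<in>I. real ((\<nu> i + 1) choose 2)"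
  have inj: "inj_on (insert i) (Pow A)"
    using assms(2) by (auto simp: inj_on_def)
  have "subset_sum b (insert i A) \<nu>
    = subset_sum b A \<nu> + (\<Sum>I\<in>insert i ` Pow A. b (card I) * ?P I)"
    unfolding subset_sum_def Pow_insert using assms by (intro sum.union_disjoint) auto
  also have "(\<Sum>I\<in>insert i ` Pow A. b (card I) * ?P I)
    = (\<Sum>I\<in>Pow A. b (card (insert i I)) * ?P (insert i I))"
    by (simp add: sum.reindex[OF inj])
  also have "\<dots> = (\<Sum>I\<in>Pow A. real ((\<nu> i + 1) choose 2) * (b (Suc (card I)) * ?P I))"
  proof (rule sum.cong[OF refl])
    fix I assume "I \<in> Pow A"
    then have "finite I" "i \<notin> I"
      using assms finite_subset by auto
    then show "b (card (insert i I)) * ?P (insert i I)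
      = real ((\<nu> i + 1) choose 2) * (b (Suc (card I)) * ?P I)"
      by simp
  qed
  also have "\<dots> = real ((\<nu> i + 1) choose 2) * subset_sum (\<lambda>k. b (Suc k)) A \<nu>"
    by (simp add: subset_sum_def sum_distrib_left)
  finally show ?thesis .
qed

lemma subset_sum_mono:
  assumes "finite A" "\<And>k. k \<le> card A \<Longrightarrow> b k \<le> c k"
  shows "subset_sum b A \<nu> \<le> subset_sum c A \<nu>"
  unfolding subset_sum_def using assms
  by (intro sum_mono mult_right_mono prod_nonneg) (auto intro: card_mono)

text \<open>The subset \<open>I = A\<close> alone makes the sum positive, since positive parts have positive
  triangular numbers.\<close>

lemma subset_sum_pos:
  assumes "finite A" "\<And>k. k \<le> card A \<Longrightarrow> 0 \<le> b k" "0 < b (card A)" "\<And>i. i \<in> A \<Longrightarrow> 1 \<le> \<nu> i"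
  shows "0 < subset_sum b A \<nu>"
  unfolding subset_sum_def
proof (rule sum_pos2)
  have "0 < (\<Prod>i\<in>A. real ((\<nu> i + 1) choose 2))"
    using assms(4) by (intro prod_pos) (auto simp: real_Suc_choose_two intro: Suc_le_lessD)
  then show "0 < b (card A) * (\<Prod>i\<in>A. real ((\<nu> i + 1) choose 2))"
    using assms(3) by simp
  show "0 \<le> b (card I) * (\<Prod>i\<in>I. real ((\<nu> i + 1) choose 2))" if "I \<in> Pow A" for I
    using that assms(1,2) by (intro mult_nonneg_nonneg prod_nonneg) (auto intro: card_mono)
qed (use assms in auto)

lemma subset_sum_permute:
  assumes "\<pi> permutes A"
  shows "subset_sum b A (\<nu> \<circ> \<pi>) = subset_sum b A \<nu>"
proof -
  have inj: "inj_on \<pi> I" for I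
    using permutes_inj[OF assms] by (rule inj_on_subset) simp
  have bij: "bij_betw (image \<pi>) (Pow A) (Pow A)"
    using permutes_imp_bij[OF assms] by (rule bij_betw_Pow)
  show ?thesis
    unfolding subset_sum_def
    by (subst sum.reindex_bij_betw[OF bij, symmetric])
      (simp add: card_image[OF inj] prod.reindex[OF inj])
qed

lemma S_reordering:
  assumes "reordering w \<mu> \<nu>"
  shows "S w a \<mu> = S w a \<nu>"
proof -
  obtain \<pi> where \<pi>: "\<pi> permutes {1..w}" and eq: "\<And>i. i \<in> {1..w} \<Longrightarrow> \<mu> i = (\<nu> \<circ> \<pi>) i"
    using assms unfolding reordering_def by auto
  have "subset_sum a {1..w} \<mu> = subset_sum a {1..w} (\<nu> \<circ> \<pi>)"
    by (rule subset_sum_cong) (rule eq)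
  then show ?thesis
    by (simp only: S_eq_subset_sum subset_sum_permute[OF \<pi>])
qed

section \<open>Moving a unit from a large part to a small one\<close>

definition transfer :: "'a \<Rightarrow> 'a \<Rightarrow> ('a \<Rightarrow> nat) \<Rightarrow> 'a \<Rightarrow> nat" where
  "transfer i j \<nu> = \<nu>(i := \<nu> i - 1, j := \<nu> j + 1)"

text \<open>Splitting off \<open>i\<close> and \<open>j\<close> leaves three sums \<open>A0\<close>, \<open>A1\<close>, \<open>A2\<close> that the transfer does not
  touch. The change of the whole sum then factors as
  \<open>(x - y - 1) * (x * (y + 1) / 2 * A2 - A1)\<close> with both factors positive.\<close>

lemma subset_sum_less_transfer:
  fixes b :: "nat \<Rightarrow> real"
  assumes A: "finite A" "i \<in> A" "j \<in> A"
    and parts: "\<And>l. l \<in> A \<Longrightarrow> 1 \<le> \<nu> l" and gap: "\<nu> j + 2 \<le> \<nu> i"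
    and nonneg: "\<And>k. k \<le> card A \<Longrightarrow> 0 \<le> b k" and pos: "0 < b (card A)"
    and mono: "\<And>k. k < card A \<Longrightarrow> b k \<le> b (Suc k)"
  shows "subset_sum b A \<nu> < subset_sum b A (transfer i j \<nu>)"
proof -
  define R where "R = A - {i, j}"
  have R: "finite R" "i \<notin> R" "j \<notin> R" "i \<noteq> j" and A_eq: "A = insert i (insert j R)"
    using A gap by (auto simp: R_def)
  have card_A: "card A = Suc (Suc (card R))"
    using R by (simp add: A_eq)
  let ?\<nu>' = "transfer i j \<nu>"
  define A0 where "A0 = subset_sum b R \<nu>"
  define A1 where "A1 = subset_sum (\<lambda>k. b (Suc k)) R \<nu>"
  define A2 where "A2 = subset_sum (\<lambda>k. b (Suc (Suc k))) R \<nu>"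
  define x where "x = real (\<nu> i)"
  define y where "y = real (\<nu> j)"
  have xy: "1 \<le> y" "y + 2 \<le> x"
    using parts[OF A(3)] gap by (auto simp: x_def y_def)
  have split: "subset_sum b A f = subset_sum b R f
      + (real ((f i + 1) choose 2) + real ((f j + 1) choose 2)) * subset_sum (\<lambda>k. b (Suc k)) R f
      + real ((f i + 1) choose 2) * real ((f j + 1) choose 2)
        * subset_sum (\<lambda>k. b (Suc (Suc k))) R f" for f
    using R by (simp add: A_eq subset_sum_insert algebra_simps)
  have same: "subset_sum c R ?\<nu>' = subset_sum c R \<nu>" for c
    using R by (intro subset_sum_cong) (auto simp: transfer_def)
  have old: "subset_sum b A \<nu> = A0 + (x * (x + 1) / 2 + y * (y + 1) / 2) * A1
      + x * (x + 1) / 2 * (y * (y + 1) / 2) * A2"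
    by (simp only: split real_Suc_choose_two A0_def A1_def A2_def x_def y_def)
  have "real (?\<nu>' i) = x - 1" "real (?\<nu>' j) = y + 1"
    using R(4) gap by (auto simp: transfer_def x_def y_def of_nat_diff)
  then have new: "subset_sum b A ?\<nu>' = A0
      + ((x - 1) * x / 2 + (y + 1) * (y + 2) / 2) * A1
      + (x - 1) * x / 2 * ((y + 1) * (y + 2) / 2) * A2"
    by (simp only: split same real_Suc_choose_two A0_def A1_def A2_def) (simp add: algebra_simps)
  have diff: "subset_sum b A ?\<nu>' - subset_sum b A \<nu> = (x - y - 1) * (x * (y + 1) / 2 * A2 - A1)"
    unfolding old new by (simp add: field_simps)
  have "A1 \<le> A2"
    unfolding A1_def A2_def using R(1) mono by (intro subset_sum_mono) (auto simp: card_A)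
  moreover have "0 < A2"
    unfolding A2_def using R(1) nonneg pos parts
    by (intro subset_sum_pos) (auto simp: card_A R_def)
  moreover have "3 * 2 \<le> x * (y + 1)"
    using xy by (intro mult_mono) auto
  then have "3 * A2 \<le> x * (y + 1) / 2 * A2"
    using \<open>0 < A2\<close> by (intro mult_right_mono) auto
  ultimately have "0 < x * (y + 1) / 2 * A2 - A1"
    by linarith
  then have "0 < (x - y - 1) * (x * (y + 1) / 2 * A2 - A1)"
    using xy by (intro mult_pos_pos) auto
  then show ?thesis
    using diff by linarith
qed

text \<open>This is applied to the identity, for the total of a composition, and to squares, for the
  termination measure. The terms removed stand on the left so that no subtraction of sums of
  natural numbers occurs.\<close>

lemma sum_transfer:
  fixes f :: "nat \<Rightarrow> nat"
  assumes "finite A" "i \<in> A" "j \<in> A" "i \<noteq> j"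
  shows "(\<Sum>l\<in>A. f (transfer i j \<nu> l)) + f (\<nu> i) + f (\<nu> j)
    = (\<Sum>l\<in>A. f (\<nu> l)) + f (\<nu> i - 1) + f (\<nu> j + 1)"
proof -
  define R where "R = A - {i, j}"
  have R: "finite R" "i \<notin> R" "j \<notin> R" and A_eq: "A = insert i (insert j R)"
    using assms by (auto simp: R_def)
  have "(\<Sum>l\<in>R. f (transfer i j \<nu> l)) = (\<Sum>l\<in>R. f (\<nu> l))"
    using R by (intro sum.cong) (auto simp: transfer_def)
  then show ?thesis
    using R assms(4) by (simp add: A_eq transfer_def)
qed

lemma composition_transfer:
  assumes "composition w n \<nu>" "i \<in> {1..w}" "j \<in> {1..w}" "\<nu> j + 2 \<le> \<nu> i"
  shows "composition w n (transfer i j \<nu>)"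
proof -
  have "i \<noteq> j"
    using assms(4) by auto
  then have "(\<Sum>l = 1..w. transfer i j \<nu> l) = (\<Sum>l = 1..w. \<nu> l)"
    using sum_transfer[of "{1..w}" i j "\<lambda>m. m" \<nu>] assms(2-4) by simp
  then show ?thesis
    using assms by (auto simp: composition_def transfer_def)
qed

lemma sum_squares_transfer_less:
  assumes "finite A" "i \<in> A" "j \<in> A" "\<nu> j + 2 \<le> \<nu> i"
  shows "(\<Sum>l\<in>A. (transfer i j \<nu> l)\<^sup>2) < (\<Sum>l\<in>A. (\<nu> l)\<^sup>2)"
proof -
  have "i \<noteq> j"
    using assms(4) by auto
  obtain d where d: "\<nu> i = \<nu> j + 2 + d"
    using assms(4) le_Suc_ex by blast
  then have "\<nu> i - 1 = \<nu> j + 1 + d"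
    by simp
  then have "(\<nu> i - 1)\<^sup>2 + (\<nu> j + 1)\<^sup>2 < (\<nu> i)\<^sup>2 + (\<nu> j)\<^sup>2"
    unfolding d by (simp add: power2_eq_square algebra_simps)
  with sum_transfer[of A i j "\<lambda>m. m\<^sup>2" \<nu>] assms(1-3) \<open>i \<noteq> j\<close> show ?thesis
    by linarith
qed

lemma not_balanced_gap:
  assumes "\<not> balanced w \<nu>"
  obtains i j where "i \<in> {1..w}" "j \<in> {1..w}" "\<nu> j + 2 \<le> \<nu> i"
proof -
  obtain i j where ij: "i \<in> {1..w}" "j \<in> {1..w}" "\<bar>int (\<nu> i) - int (\<nu> j)\<bar> \<notin> {0, 1}"
    using assms unfolding balanced_def by blast
  then have "\<nu> j + 2 \<le> \<nu> i \<or> \<nu> i + 2 \<le> \<nu> j"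
    by auto
  with ij that show thesis
    by blast
qed

text \<open>Compositions are functions on all of \<open>nat\<close>, so there are infinitely many of them and a
  maximiser cannot simply be chosen. Transferring units until nothing is left to transfer
  reaches one instead; each step strictly increases \<open>S\<close> and decreases the sum of squares.\<close>

lemma ex_balanced_improvement:
  assumes a: "\<And>k. 0 \<le> a k" "0 < a w" "\<And>k. k < w \<Longrightarrow> a k \<le> a (Suc k)"
    and "composition w n \<mu>"
  shows "\<exists>\<nu>. composition w n \<nu> \<and> balanced w \<nu> \<and> S w a \<mu> \<le> S w a \<nu>
    \<and> (\<not> balanced w \<mu> \<longrightarrow> S w a \<mu> < S w a \<nu>)"
  using assms(4)
proof (induction "\<Sum>l = 1..w. (\<mu> l)\<^sup>2" arbitrary: \<mu> rule: less_induct)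
  case less
  show ?case
  proof (cases "balanced w \<mu>")
    case True
    with less.prems show ?thesis by blast
  next
    case False
    then obtain i j where ij: "i \<in> {1..w}" "j \<in> {1..w}" and gap: "\<mu> j + 2 \<le> \<mu> i"
      by (rule not_balanced_gap)
    have "(\<Sum>l = 1..w. (transfer i j \<mu> l)\<^sup>2) < (\<Sum>l = 1..w. (\<mu> l)\<^sup>2)"
      by (rule sum_squares_transfer_less[OF _ ij gap]) simp
    moreover have "composition w n (transfer i j \<mu>)"
      by (rule composition_transfer[OF less.prems ij gap])
    ultimately obtain \<nu> where \<nu>: "composition w n \<nu>" "balanced w \<nu>"
        "S w a (transfer i j \<mu>) \<le> S w a \<nu>"
      using less.hyps by blast
    have "S w a \<mu> < S w a (transfer i j \<mu>)"
      unfolding S_eq_subset_sum using a less.prems gap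
      by (intro subset_sum_less_transfer[OF _ ij]) (auto simp: composition_def)
    with \<nu> show ?thesis
      by force
  qed
qed

section \<open>Balanced compositions\<close>

lemma sum_balanced:
  fixes \<nu> :: "'a \<Rightarrow> nat"
  assumes "finite A" "\<And>i. i \<in> A \<Longrightarrow> \<nu> i = m \<or> \<nu> i = Suc m"
  shows "(\<Sum>i\<in>A. \<nu> i) = card A * m + card {i \<in> A. \<nu> i = Suc m}"
proof -
  have "(\<Sum>i\<in>A. \<nu> i) = (\<Sum>i\<in>A. m + (if \<nu> i = Suc m then 1 else 0))"
    using assms(2) by (intro sum.cong) auto
  then show ?thesis
    using assms(1) by (simp add: sum.distrib sum.If_cases Int_def conj_commute)
qed

lemma balanced_parts:
  assumes "1 \<le> w" "composition w n \<nu>" "balanced w \<nu>"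
  shows "\<And>i. i \<in> {1..w} \<Longrightarrow> \<nu> i = n div w \<or> \<nu> i = Suc (n div w)"
    and "card {i \<in> {1..w}. \<nu> i = Suc (n div w)} = n mod w"
proof -
  define m where "m = Min (\<nu> ` {1..w})"
  have "m \<in> \<nu> ` {1..w}"
    unfolding m_def using assms(1) by (intro Min_in) auto
  then obtain i0 where i0: "i0 \<in> {1..w}" "\<nu> i0 = m"
    by auto
  have parts: "\<nu> i = m \<or> \<nu> i = Suc m" if "i \<in> {1..w}" for i
  proof -
    have "m \<le> \<nu> i"
      unfolding m_def using that by (intro Min_le) auto
    moreover have "\<bar>int (\<nu> i) - int m\<bar> \<in> {0, 1}"
      using assms(3) that i0 unfolding balanced_def by blast
    ultimately show ?thesis
      by auto
  qed
  let ?c = "card {i \<in> {1..w}. \<nu> i = Suc m}"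
  have n: "n = w * m + ?c"
    using sum_balanced[of "{1..w}" \<nu> m] parts assms(2) by (simp add: composition_def)
  \<comment> \<open>The smallest part is counted in \<open>w\<close> but not in \<open>?c\<close>, so \<open>?c\<close> is a remainder modulo \<open>w\<close>.\<close>
  have "{i \<in> {1..w}. \<nu> i = Suc m} \<subset> {1..w}"
  proof (rule psubsetI)
    show "{i \<in> {1..w}. \<nu> i = Suc m} \<noteq> {1..w}"
      using i0 n_not_Suc_n[of m] by blast
  qed auto
  from psubset_card_mono[OF _ this] have c: "?c < w"
    by simp
  have "n div w = m"
    using c by (subst n) (simp add: div_mult_self3)
  moreover have "n mod w = ?c"
    using c by (subst n) simp
  ultimately show "\<And>i. i \<in> {1..w} \<Longrightarrow> \<nu> i = n div w \<or> \<nu> i = Suc (n div w)"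
    and "card {i \<in> {1..w}. \<nu> i = Suc (n div w)} = n mod w"
    using parts by simp_all
qed

text \<open>Division with remainder fixes how often each value occurs, and tuples with the same
  multiset of parts are permutations of each other.\<close>

lemma reordering_if_balanced:
  assumes "1 \<le> w"
    and \<mu>: "composition w n \<mu>" "balanced w \<mu>" and \<nu>: "composition w n \<nu>" "balanced w \<nu>"
  shows "reordering w \<mu> \<nu>"
proof -
  have count: "card {i \<in> {1..w}. f i = v} =
      (if v = Suc (n div w) then n mod w else if v = n div w then w - n mod w else 0)"
    if f: "composition w n f" "balanced w f" for f v
  proof -
    note parts = balanced_parts(1)[OF assms(1) f] and card_Suc = balanced_parts(2)[OF assms(1) f]
    have "{i \<in> {1..w}. f i = n div w} = {1..w} - {i \<in> {1..w}. f i = Suc (n div w)}"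
      using parts by force
    then have "card {i \<in> {1..w}. f i = n div w} = w - n mod w"
      using card_Diff_subset[of "{i \<in> {1..w}. f i = Suc (n div w)}" "{1..w}"] card_Suc by force
    moreover have "{i \<in> {1..w}. f i = v} = {}" if "v \<noteq> n div w" "v \<noteq> Suc (n div w)"
      using parts that by blast
    ultimately show ?thesis
      using card_Suc by auto
  qed
  have "image_mset \<mu> (mset_set {1..w}) = image_mset \<nu> (mset_set {1..w})"
  proof (rule multiset_eqI)
    fix v
    have "{i. i \<in> {1..w} \<and> v = f i} = {i \<in> {1..w}. f i = v}" for f :: "nat \<Rightarrow> nat"
      by auto
    then show "count (image_mset \<mu> (mset_set {1..w})) v = count (image_mset \<nu> (mset_set {1..w})) v"
      using count[OF \<mu>, of v] count[OF \<nu>, of v] by (simp add: count_image_mset')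
  qed
  then obtain \<pi> where "\<pi> permutes {1..w}" "\<forall>i\<in>{1..w}. \<mu> i = \<nu> (\<pi> i)"
    using image_mset_eq_implies_permutes[of "{1..w}" \<mu> \<nu>] by blast
  then show ?thesis
    unfolding reordering_def by blast
qed

lemma ex_balanced_composition:
  assumes "1 \<le> w" "w \<le> n"
  shows "\<exists>\<nu>. composition w n \<nu> \<and> balanced w \<nu>"
proof -
  define \<nu> where "\<nu> i = (if i \<le> n mod w then Suc (n div w) else n div w)" for i
  have "n mod w \<le> w"
    using assms(1) by simp
  then have "{i \<in> {1..w}. \<nu> i = Suc (n div w)} = {1..n mod w}"
    by (auto simp: \<nu>_def split: if_splits)
  then have "(\<Sum>i = 1..w. \<nu> i) = n"
    using sum_balanced[of "{1..w}" \<nu> "n div w"] by (auto simp: \<nu>_def)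
  moreover have "1 \<le> n div w"
    using assms by (simp add: div_greater_zero_iff Suc_leI)
  ultimately have "composition w n \<nu>"
    by (auto simp: composition_def \<nu>_def)
  moreover have "balanced w \<nu>"
    by (auto simp: balanced_def \<nu>_def)
  ultimately show ?thesis
    by blast
qed

section \<open>The maximisers\<close>

theorem proposition7p1:
  fixes w n :: nat and a :: "nat \<Rightarrow> real"
  assumes "w \<ge> 2"
    and "\<And>k. a k \<ge> 0"
    and "\<And>k. k \<in> {1..w} \<Longrightarrow> a (k - 1) \<le> a k"
  shows "(\<forall>\<nu>. composition w n \<nu> \<and> balanced w \<nu> \<longrightarrow> is_arg_max (S w a) (composition w n) \<nu>)
    \<and> (n \<ge> w \<longrightarrow> (\<exists>\<nu>. composition w n \<nu> \<and> balanced w \<nu>))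
    \<and> (\<forall>\<mu> \<nu>. composition w n \<mu> \<and> balanced w \<mu> \<and> composition w n \<nu> \<and> balanced w \<nu>
          \<longrightarrow> reordering w \<mu> \<nu>)
    \<and> ((\<exists>k\<in>{0..w}. a k \<noteq> 0) \<longrightarrow>
        (\<forall>\<mu> \<nu>. is_arg_max (S w a) (composition w n) \<mu> \<and> is_arg_max (S w a) (composition w n) \<nu>
          \<longrightarrow> reordering w \<mu> \<nu>))"
proof -
  have w: "1 \<le> w"
    using assms(1) by simp
  have step: "a k \<le> a (Suc k)" if "k < w" for k
    using assms(3)[of "Suc k"] that by simp
  have le_last: "a k \<le> a w" if "k \<le> w" for k
    using that by (induction rule: inc_induct) (auto intro: step order_trans)
  have pos_last: "0 < a w" if "\<exists>k\<in>{0..w}. a k \<noteq> 0"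
  proof -
    obtain k where "k \<le> w" "a k \<noteq> 0"
      using \<open>\<exists>k\<in>{0..w}. a k \<noteq> 0\<close> by auto
    then show ?thesis
      using le_last[of k] assms(2)[of k] by linarith
  qed
  have arg_max: "is_arg_max (S w a) (composition w n) \<nu>"
    if \<nu>: "composition w n \<nu>" "balanced w \<nu>" for \<nu>
  proof (cases "\<exists>k\<in>{0..w}. a k \<noteq> 0")
    case True
    have "S w a \<mu> \<le> S w a \<nu>" if \<mu>: "composition w n \<mu>" for \<mu>
    proof -
      obtain \<nu>' where \<nu>': "composition w n \<nu>'" "balanced w \<nu>'" "S w a \<mu> \<le> S w a \<nu>'"
        using ex_balanced_improvement[OF assms(2) pos_last[OF True] step \<mu>] by blast
      moreover have "S w a \<nu>' = S w a \<nu>"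
        by (intro S_reordering reordering_if_balanced[OF w \<nu>'(1,2) \<nu>])
      ultimately show ?thesis
        by simp
    qed
    then show ?thesis
      using \<nu>(1) by (force simp: is_arg_max_def)
  next
    case False
    then have "S w a \<mu> = 0" for \<mu>
      unfolding S_def by (intro sum.neutral) auto
    then show ?thesis
      using \<nu>(1) by (simp add: is_arg_max_def)
  qed
  have "balanced w \<mu>"
    if nz: "\<exists>k\<in>{0..w}. a k \<noteq> 0" and \<mu>: "is_arg_max (S w a) (composition w n) \<mu>" for \<mu>
    using ex_balanced_improvement[OF assms(2) pos_last[OF nz] step, of n \<mu>] \<mu>
    by (auto simp: is_arg_max_def)
  then have "reordering w \<mu> \<nu>"
    if "\<exists>k\<in>{0..w}. a k \<noteq> 0" "is_arg_max (S w a) (composition w n) \<mu>"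
      "is_arg_max (S w a) (composition w n) \<nu>" for \<mu> \<nu>
    using that by (intro reordering_if_balanced[OF w]) (auto simp: is_arg_max_def)
  with arg_max show ?thesis
    using ex_balanced_composition[OF w] reordering_if_balanced[OF w] by blast
qed

end
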